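(* Let $\lambda>0$ be an arbitrary real number (the damping parameter). Then both of the following hold. (A) Let $f$ be a Newton map and let $c_1<c_2$ be two consecutive roots of $f'$ such that in the interval $(c_1,c_2)$ there is a unique root of $f$. Then $$\lim_{x\to c_1+}N_{\lambda,f}(x)=-\lim_{x\to c_2-}N_{\lambda,f}(x)=\pm\infty,$$ that is, the two one-sided limits are infinite and of opposite signs. (B) Let $f\colon\mathbb{R}\to\mathbb{R}$ be a function with the following properties: (i) $f$ is a Newton map; (ii) $\lim_{x\to+\infty}f(x)=-\lim_{x\to-\infty}f(x)=\pm\infty$, that is, $f$ has infinite limits of opposite signs at $+\infty$ and $-\infty$; (iii) $f$ has at least four real roots. Then: (a) $M_{\lambda,f}$ has periodic points of any prime period, that is, for every integer $n\geq 1$ there is a periodic point of $M_{\lambda,f}$ of prime period $n$. (b) The set of all real numbers $a$ for which the sequence $(M_{\lambda,f}^n(a))_{n\in\mathbb{N}}$ does not converge is uncountable. Hence, for the class of functions satisfying (i)–(iii), the chaotic behaviour characterised by the existence of periodic points of any prime period, as well as the uncountability of the set of points of divergence of the iteration (both of which hold for the undamped function, $\lambda=1$), remain unaltered by damping.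
   Context: A Newton map (also called a Newton's function) is a function $f\colon\mathbb{R}\to\mathbb{R}$ such that: $f$ is of class $\mathcal{C}^2(\mathbb{R})$; for every $x\in\mathbb{R}$, if $f(x)=0$ then $f'(x)\neq 0$; and for every $x\in\mathbb{R}$, if $f'(x)=0$ then $f''(x)\neq 0$. For a differentiable function $f\colon\mathbb{R}\to\mathbb{R}$ and a damping parameter $\lambda$, the damped Newton's functions are $N_{\lambda,f}(x)=x-\lambda\frac{f(x)}{f'(x)}$ and $M_{\lambda,f}(x)=N_{\lambda,f}(x)-\lambda\frac{f(N_{\lambda,f}(x))}{f'(x)}$, both defined for all $x\in\mathbb{R}$ with $f'(x)\neq 0$. $M_{\lambda,f}^n$ denotes the $n$-fold iterate; since $M_{\lambda,f}$ is only partially defined, $M_{\lambda,f}^n(a)$ makes sense when $f'(M_{\lambda,f}^i(a))\neq 0$ for all $0\le i<n$ (with $M_{\lambda,f}^0(a)=a$). A periodic point of $M_{\lambda,f}$ is a point $a$ such that, for some integer $n\geq 1$, $M_{\lambda,f}^n(a)$ is defined and $M_{\lambda,f}^n(a)=a$; the least such $n$ is its prime period. In (B)(b), the points $a$ considered are those for which $M_{\lambda,f}^n(a)$ is defined for all $n\in\mathbb{N}$ and the resulting sequence of real numbers does not converge in $\mathbb{R}$. *)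

theory Defs
  imports "HOL-Analysis.Analysis"
begin

definition C2_fun :: "(real \<Rightarrow> real) \<Rightarrow> bool" where
  "C2_fun f \<longleftrightarrow> f differentiable_on UNIV \<and> deriv f differentiable_on UNIV
     \<and> continuous_on UNIV (deriv (deriv f))"

definition newton_map :: "(real \<Rightarrow> real) \<Rightarrow> bool" where
  "newton_map f \<longleftrightarrow> C2_fun f
     \<and> (\<forall>x. f x = 0 \<longrightarrow> deriv f x \<noteq> 0)
     \<and> (\<forall>x. deriv f x = 0 \<longrightarrow> deriv (deriv f) x \<noteq> 0)"

text \<open>
  The damped Newton functions are defined only where the derivative of \<open>f\<close> is nonzero.
  Elsewhere the values of \<open>newton_N\<close> and \<open>newton_M\<close> (division by zero) are meaningless; whether an
  iterate of \<open>newton_M\<close> is genuinely defined is recorded separately by \<open>M_iter_defined\<close>.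
\<close>

definition newton_N :: "real \<Rightarrow> (real \<Rightarrow> real) \<Rightarrow> real \<Rightarrow> real" where
  "newton_N l f x = x - l * (f x / deriv f x)"

definition newton_M :: "real \<Rightarrow> (real \<Rightarrow> real) \<Rightarrow> real \<Rightarrow> real" where
  "newton_M l f x = newton_N l f x - l * (f (newton_N l f x) / deriv f x)"

definition M_iter_defined :: "real \<Rightarrow> (real \<Rightarrow> real) \<Rightarrow> nat \<Rightarrow> real \<Rightarrow> bool" where
  "M_iter_defined l f n a \<longleftrightarrow> (\<forall>i<n. deriv f ((newton_M l f ^^ i) a) \<noteq> 0)"

definition M_returns :: "real \<Rightarrow> (real \<Rightarrow> real) \<Rightarrow> nat \<Rightarrow> real \<Rightarrow> bool" where
  "M_returns l f n a \<longleftrightarrow> n \<ge> 1 \<and> M_iter_defined l f n a \<and> (newton_M l f ^^ n) a = a"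

definition M_prime_period :: "real \<Rightarrow> (real \<Rightarrow> real) \<Rightarrow> nat \<Rightarrow> real \<Rightarrow> bool" where
  "M_prime_period l f n a \<longleftrightarrow> M_returns l f n a \<and> (\<forall>m<n. \<not> M_returns l f m a)"

definition M_divergence_set :: "real \<Rightarrow> (real \<Rightarrow> real) \<Rightarrow> real set" where
  "M_divergence_set l f =
     {a. (\<forall>n. M_iter_defined l f n a) \<and> \<not> convergent (\<lambda>n. (newton_M l f ^^ n) a)}"

definition consecutive_roots :: "(real \<Rightarrow> real) \<Rightarrow> real \<Rightarrow> real \<Rightarrow> bool" where
  "consecutive_roots g a b \<longleftrightarrow> a < b \<and> g a = 0 \<and> g b = 0 \<and> (\<forall>x\<in>{a<..<b}. g x \<noteq> 0)"

definition opposite_infinite_limits ::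
    "(real \<Rightarrow> real) \<Rightarrow> real filter \<Rightarrow> real filter \<Rightarrow> bool" where
  "opposite_infinite_limits g F G \<longleftrightarrow>
     (filterlim g at_top F \<and> filterlim g at_bot G) \<or>
     (filterlim g at_bot F \<and> filterlim g at_top G)"

end

theory Submission
  imports Defs
begin

text \<open>
  Put \<open>N = newton_N l f\<close> and \<open>M = newton_M l f\<close>. Eliminating \<open>f'(x)\<close> gives
  \<open>M x = x + (N x - x) * (1 + f (N x) / f x)\<close>. At the ends of an interval between consecutive
  critical points that contains a root of \<open>f\<close>, \<open>N\<close> tends to \<open>+\<infinity>\<close> and to \<open>-\<infinity>\<close>; as \<open>f\<close> has infinite
  limits of opposite signs and nonzero values of opposite signs at the two critical points, \<open>M\<close> also
  has infinite limits of opposite signs there. Each of the two middle ones of four roots lies in such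
  an interval, and the two intervals are disjoint. Suitable compact subintervals are both mapped by
  \<open>M\<close> over their union, so every itinerary in the two symbols is realised, periodic ones by periodic
  points.
\<close>

section \<open>Horseshoes of interval maps\<close>

lemma closed_subset_interval_compact:
  fixes S :: "real set"
  assumes "closed S" "S \<subseteq> {a..b}"
  shows "compact S"
  using closed_Int_compact[OF assms(1) compact_Icc[of a b]] assms(2) by (simp add: Int_absorb2)

section \<open>Subintervals with a prescribed image\<close>

text \<open>Take \<open>u'\<close> as the last point where \<open>g\<close> equals \<open>c\<close>,
  and \<open>v'\<close> as the first point from there on where \<open>g\<close> equals
  \<open>d\<close>. If \<open>g\<close> left \<open>{c..d}\<close> in between, the intermediate
  value theorem would give a later \<open>c\<close> or an earlier \<open>d\<close>.\<close>

lemma interval_covered_exactly_increasing: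
  fixes g :: "real \<Rightarrow> real"
  assumes uv: "u \<le> v" and cont: "continuous_on {u..v} g" and "g u = c" "g v = d" and cd: "c \<le> d"
  shows "\<exists>u' v'. u \<le> u' \<and> u' \<le> v' \<and> v' \<le> v \<and> g ` {u'..v'} = {c..d}"
proof -
  let ?S = "{x \<in> {u..v}. g x = c}"
  have "closed ?S"
    using continuous_closed_preimage_constant[OF cont] by simp
  then have "compact ?S"
    by (rule closed_subset_interval_compact) auto
  moreover have "u \<in> ?S" using uv \<open>g u = c\<close> by simp
  ultimately obtain u' where "u' \<in> ?S" and u'_max: "\<forall>x\<in>?S. x \<le> u'"
    using compact_attains_sup[of ?S] by blast
  then have u': "u \<le> u'" "u' \<le> v" "g u' = c" by simp_all
  have cont': "continuous_on {u'..v} g"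
    using cont by (rule continuous_on_subset) (use u' in auto)
  let ?T = "{x \<in> {u'..v}. g x = d}"
  have "closed ?T"
    using continuous_closed_preimage_constant[OF cont'] by simp
  then have "compact ?T"
    by (rule closed_subset_interval_compact) auto
  moreover have "v \<in> ?T" using u' \<open>g v = d\<close> by simp
  ultimately obtain v' where "v' \<in> ?T" and v'_min: "\<forall>x\<in>?T. v' \<le> x"
    using compact_attains_inf[of ?T] by blast
  then have v': "u' \<le> v'" "v' \<le> v" "g v' = d" by simp_all
  have cont'': "continuous_on {x..y} g" if "u' \<le> x" "y \<le> v'" for x y
    using cont by (rule continuous_on_subset) (use u' v' that in auto)
  have "g x \<in> {c..d}" if x: "x \<in> {u'..v'}" for x
  proof -
    have "c \<le> g x"
    proof (rule ccontr)
      assume "\<not> c \<le> g x"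
      then have "\<exists>y\<ge>x. y \<le> v' \<and> g y = c"
        by (intro IVT' cont'') (use x v' cd in auto)
      then obtain y where "x \<le> y" "y \<le> v'" "g y = c" by blast
      moreover from this have "y \<le> u'" using u'_max u' v' x by force
      ultimately have "y = x" using x by simp
      then show False using \<open>g y = c\<close> \<open>\<not> c \<le> g x\<close> by simp
    qed
    moreover have "g x \<le> d"
    proof (rule ccontr)
      assume "\<not> g x \<le> d"
      then have "\<exists>y\<ge>u'. y \<le> x \<and> g y = d"
        by (intro IVT' cont'') (use x u' cd in auto)
      then obtain y where "u' \<le> y" "y \<le> x" "g y = d" by blast
      moreover from this have "v' \<le> y" using v'_min v' x by force
      ultimately have "y = x" using x by simp
      then show False using \<open>g y = d\<close> \<open>\<not> g x \<le> d\<close> by simp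
    qed
    ultimately show ?thesis by simp
  qed
  moreover have "y \<in> g ` {u'..v'}" if "y \<in> {c..d}" for y
  proof -
    have "\<exists>x\<ge>u'. x \<le> v' \<and> g x = y"
      by (intro IVT' cont'') (use that u' v' in auto)
    then show ?thesis by (auto simp: image_iff)
  qed
  ultimately have "g ` {u'..v'} = {c..d}" by blast
  then show ?thesis using u' v' by blast
qed

lemma interval_covered_exactly:
  fixes g :: "real \<Rightarrow> real"
  assumes cont: "continuous_on {a..b} g" and cd: "c \<le> d" and sub: "{c..d} \<subseteq> g ` {a..b}"
  shows "\<exists>u v. a \<le> u \<and> u \<le> v \<and> v \<le> b \<and> g ` {u..v} = {c..d}"
proof -
  obtain x y where x: "x \<in> {a..b}" "g x = c" and y: "y \<in> {a..b}" "g y = d"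
    using subsetD[OF sub, of c] subsetD[OF sub, of d] cd by (auto simp: image_iff)
  show ?thesis
  proof (cases "x \<le> y")
    case True
    have "continuous_on {x..y} g"
      using cont by (rule continuous_on_subset) (use x y in auto)
    from interval_covered_exactly_increasing[OF True this x(2) y(2) cd]
    obtain u v where "x \<le> u" "u \<le> v" "v \<le> y" "g ` {u..v} = {c..d}" by blast
    then show ?thesis using x y by (intro exI[of _ u] exI[of _ v]) auto
  next
    case False
    \<comment> \<open>The preimages come in reverse order, so \<open>- g\<close> goes from
      \<open>-d\<close> at \<open>y\<close> to \<open>-c\<close> at \<open>x\<close>.\<close>
    have "continuous_on {y..x} (\<lambda>z. - g z)"
      by (intro continuous_on_minus continuous_on_subset[OF cont]) (use x y in auto)
    with interval_covered_exactly_increasing[of y x "\<lambda>z. - g z" "-d" "-c"]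
    obtain u v where uv: "y \<le> u" "u \<le> v" "v \<le> x" and "(\<lambda>z. - g z) ` {u..v} = {-d..-c}"
      using False x y cd by auto
    then have "uminus ` (\<lambda>z. - g z) ` {u..v} = {c..d}" by simp
    then have "g ` {u..v} = {c..d}" by (simp add: image_image)
    then show ?thesis using x y uv by (intro exI[of _ u] exI[of _ v]) auto
  qed
qed

text \<open>\<open>h z - z\<close> is at most 0 at a preimage of \<open>u\<close> and at least 0 at
  a preimage of \<open>v\<close>, so it vanishes somewhere.\<close>

lemma fixed_point_if_covers:
  fixes h :: "real \<Rightarrow> real"
  assumes "u \<le> v" and cont: "continuous_on {u..v} h" and sub: "{u..v} \<subseteq> h ` {u..v}"
  shows "\<exists>x\<in>{u..v}. h x = x"
proof -
  obtain x y where x: "x \<in> {u..v}" "h x = u" and y: "y \<in> {u..v}" "h y = v"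
    using subsetD[OF sub, of u] subsetD[OF sub, of v] \<open>u \<le> v\<close> by (auto simp: image_iff)
  have "connected ((\<lambda>z. h z - z) ` {u..v})"
    by (intro connected_continuous_image continuous_intros cont) auto
  moreover have "h x - x \<in> (\<lambda>z. h z - z) ` {u..v}" "h y - y \<in> (\<lambda>z. h z - z) ` {u..v}"
    using x(1) y(1) by blast+
  ultimately have "0 \<in> (\<lambda>z. h z - z) ` {u..v}"
    using x y connectedD_interval[of "(\<lambda>z. h z - z) ` {u..v}" "h x - x" "h y - y" 0] by auto
  then show ?thesis by force
qed

section \<open>Symbolic dynamics of a two-interval horseshoe\<close>

text \<open>Symbols are truth values, \<open>False\<close> for the left interval and
  \<open>True\<close> for the right one. Continuity is confined to the two intervals because
  \<open>newton_M l f\<close> is unbounded near the critical points that separate them.\<close>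

locale horseshoe =
  fixes g :: "real \<Rightarrow> real" and p q :: "bool \<Rightarrow> real"
  assumes le: "\<And>b. p b \<le> q b"
    and disjoint: "q False < p True"
    and cont: "\<And>b. continuous_on {p b..q b} g"
    and covers: "\<And>b c. {p c..q c} \<subseteq> g ` {p b..q b}"
begin

lemma symbol_unique: "x \<in> {p b..q b} \<Longrightarrow> x \<in> {p c..q c} \<Longrightarrow> b = c"
  using disjoint by (cases b; cases c) auto

text \<open>Itineraries are pulled back: an interval realising the shifted itinerary lies in
  \<open>{p (s 1)..q (s 1)}\<close>, which is covered by the image of
  \<open>{p (s 0)..q (s 0)}\<close>. That the image at time \<open>n\<close> is a full interval
  later yields fixed points.\<close>

lemma finite_itinerary_interval:
  "\<exists>u v. p (s 0) \<le> u \<and> u \<le> v \<and> v \<le> q (s 0) \<and> continuous_on {u..v} (g ^^ n)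
     \<and> (g ^^ n) ` {u..v} = {p (s n)..q (s n)}
     \<and> (\<forall>i\<le>n. (g ^^ i) ` {u..v} \<subseteq> {p (s i)..q (s i)})"
proof (induction n arbitrary: s)
  case 0
  show ?case using le[of "s 0"] by (intro exI[of _ "p (s 0)"] exI[of _ "q (s 0)"]) auto
next
  case (Suc n)
  obtain u' v' where I: "p (s 1) \<le> u'" "u' \<le> v'" "v' \<le> q (s 1)" "continuous_on {u'..v'} (g ^^ n)"
     "(g ^^ n) ` {u'..v'} = {p (s (Suc n))..q (s (Suc n))}"
     "\<And>i. i \<le> n \<Longrightarrow> (g ^^ i) ` {u'..v'} \<subseteq> {p (s (Suc i))..q (s (Suc i))}"
    using Suc[of "\<lambda>i. s (Suc i)"] by auto
  have "{u'..v'} \<subseteq> {p (s 1)..q (s 1)}" using I by auto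
  also have "\<dots> \<subseteq> g ` {p (s 0)..q (s 0)}" by (rule covers)
  \<comment> \<open>The image is exactly \<open>{u'..v'}\<close>, so from time 1 on
    \<open>{u..v}\<close> follows the itinerary of \<open>{u'..v'}\<close>.\<close>
  finally obtain u v where uv: "p (s 0) \<le> u" "u \<le> v" "v \<le> q (s 0)" "g ` {u..v} = {u'..v'}"
    using interval_covered_exactly[OF cont I(2)] by blast
  have im: "(g ^^ Suc i) ` {u..v} = (g ^^ i) ` {u'..v'}" for i
    by (simp only: funpow_Suc_right image_comp[symmetric] uv(4))
  have "continuous_on {u..v} (g ^^ Suc n)"
    unfolding funpow_Suc_right using uv I
    by (intro continuous_on_compose continuous_on_subset[OF cont[of "s 0"]]) auto
  moreover have "(g ^^ i) ` {u..v} \<subseteq> {p (s i)..q (s i)}" if "i \<le> Suc n" for i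
  proof (cases i)
    case 0
    then show ?thesis using uv by auto
  next
    case (Suc j)
    then show ?thesis using im[of j] I(6)[of j] that by simp
  qed
  moreover have "(g ^^ Suc n) ` {u..v} = {p (s (Suc n))..q (s (Suc n))}"
    using im[of n] I(5) by simp
  ultimately show ?case using uv by blast
qed

text \<open>When the itinerary closes up, \<open>g ^^ n\<close> maps the interval realising it onto
  all of \<open>{p (s 0)..q (s 0)}\<close>, hence over itself.\<close>

lemma periodic_itinerary:
  assumes "s n = s 0"
  shows "\<exists>x. (g ^^ n) x = x \<and> (\<forall>i\<le>n. (g ^^ i) x \<in> {p (s i)..q (s i)})"
proof -
  obtain u v where I: "p (s 0) \<le> u" "u \<le> v" "v \<le> q (s 0)" "continuous_on {u..v} (g ^^ n)"
     "(g ^^ n) ` {u..v} = {p (s n)..q (s n)}"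
     "\<And>i. i \<le> n \<Longrightarrow> (g ^^ i) ` {u..v} \<subseteq> {p (s i)..q (s i)}"
    using finite_itinerary_interval[of s n] by blast
  have "{u..v} \<subseteq> (g ^^ n) ` {u..v}" using I assms by auto
  from fixed_point_if_covers[OF I(2,4) this] obtain x where "x \<in> {u..v}" "(g ^^ n) x = x"
    by blast
  then show ?thesis using I(6) by blast
qed

text \<open>The conditions from time 1 on define a preimage under \<open>g\<close>, which is closed
  within \<open>{p (s 0)..q (s 0)}\<close> because \<open>g\<close> is continuous there.\<close>

lemma compact_itinerary_set: "compact {x. \<forall>i\<le>n. (g ^^ i) x \<in> {p (s i)..q (s i)}}"
proof (induction n arbitrary: s)
  case 0
  have "{x. \<forall>i\<le>0::nat. (g ^^ i) x \<in> {p (s i)..q (s i)}} = {p (s 0)..q (s 0)}" by auto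
  then show ?case by simp
next
  case (Suc n)
  let ?T = "{x. \<forall>i\<le>n. (g ^^ i) x \<in> {p (s (Suc i))..q (s (Suc i))}}"
  have "(\<forall>i\<le>Suc n. (g ^^ i) x \<in> {p (s i)..q (s i)}) \<longleftrightarrow>
      x \<in> {p (s 0)..q (s 0)} \<and> g x \<in> ?T" for x
    unfolding less_Suc_eq_le[symmetric]
    by (subst All_less_Suc2) (simp add: funpow_Suc_right del: funpow.simps)
  then have eq: "{x. \<forall>i\<le>Suc n. (g ^^ i) x \<in> {p (s i)..q (s i)}} = {p (s 0)..q (s 0)} \<inter> g -` ?T"
    by auto
  have "closed ?T" using Suc[of "\<lambda>i. s (Suc i)"] by (rule compact_imp_closed)
  then have "closed ({p (s 0)..q (s 0)} \<inter> g -` ?T)"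
    by (intro continuous_closed_preimage cont) auto
  then show ?case unfolding eq
    by (rule closed_subset_interval_compact) auto
qed

text \<open>The sets realising the initial segments of \<open>s\<close> are compact, nonempty and
  decreasing.\<close>

lemma infinite_itinerary: "\<exists>x. \<forall>i. (g ^^ i) x \<in> {p (s i)..q (s i)}"
proof -
  let ?T = "\<lambda>n. {x. \<forall>i\<le>n. (g ^^ i) x \<in> {p (s i)..q (s i)}}"
  have ne: "?T n \<noteq> {}" for n
  proof -
    obtain u v where "u \<le> v" "\<And>i. i \<le> n \<Longrightarrow> (g ^^ i) ` {u..v} \<subseteq> {p (s i)..q (s i)}"
      using finite_itinerary_interval[of s n] by blast
    then have "u \<in> ?T n" by fastforce
    then show ?thesis by blast
  qed
  have "\<Inter>(range ?T) \<noteq> {}"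
    by (rule compact_nest) (use ne compact_itinerary_set in auto)
  then show ?thesis by blast
qed

section \<open>Divergent orbits\<close>

text \<open>Because of the gap between the intervals, a limit would lie below \<open>p True\<close>
  or above \<open>q False\<close>; the sequence would then eventually avoid one of the
  intervals.\<close>

lemma not_convergent_if_alternating:
  assumes "\<And>i. X i \<in> {p (s i)..q (s i)}" and "\<exists>\<^sub>F i in sequentially. s i" and "\<exists>\<^sub>F i in sequentially. \<not> s i"
  shows "\<not> convergent X"
proof
  assume "convergent X"
  then obtain L where L: "X \<longlonglongrightarrow> L" by (auto simp: convergent_def)
  consider "L < p True" | "q False < L" using disjoint by linarith
  then show False
  proof cases
    case 1
    have "\<forall>\<^sub>F i in sequentially. \<not> s i"
      using order_tendstoD(2)[OF L 1]
    proof (rule eventually_mono)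
      fix i assume "X i < p True" then show "\<not> s i" using assms(1)[of i] by (cases "s i") auto
    qed
    then show False using assms(2) by (simp add: frequently_def)
  next
    case 2
    have "\<forall>\<^sub>F i in sequentially. s i"
      using order_tendstoD(1)[OF L 2]
    proof (rule eventually_mono)
      fix i assume "q False < X i" then show "s i" using assms(1)[of i] by (cases "s i") auto
    qed
    then show False using assms(3) by (simp add: frequently_def)
  qed
qed

text \<open>
  A set \<open>A\<close> of naturals is coded in the positions \<open>3 k + 2\<close>; the positions \<open>3 k\<close> and \<open>3 k + 1\<close>
  make the itinerary alternate forever.
\<close>

lemma uncountable_divergent:
  "uncountable {x. (\<forall>i. (g ^^ i) x \<in> {p False..q False} \<union> {p True..q True})
      \<and> \<not> convergent (\<lambda>i. (g ^^ i) x)}"  (is "uncountable ?D")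
proof
  assume D: "countable ?D"
  define s :: "nat set \<Rightarrow> nat \<Rightarrow> bool"
    where "s A i = (if i mod 3 = 0 then True else if i mod 3 = 1 then False else i div 3 \<in> A)"
    for A i
  have "\<forall>A. \<exists>x. \<forall>i. (g ^^ i) x \<in> {p (s A i)..q (s A i)}"
    using infinite_itinerary by blast
  from choice[OF this] obtain \<phi> where \<phi>: "\<And>A i. (g ^^ i) (\<phi> A) \<in> {p (s A i)..q (s A i)}"
    by blast
  \<comment> \<open>A point determines its itinerary as the intervals are disjoint, and the symbols
    at the positions \<open>3 * k + 2\<close> determine the set.\<close>
  have "inj \<phi>"
  proof (rule injI)
    fix A B assume "\<phi> A = \<phi> B"
    then have "s A i = s B i" for i
      using symbol_unique[OF \<phi>[of i A]] \<phi>[of i B] by simp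
    moreover have "s A (3 * k + 2) \<longleftrightarrow> k \<in> A" for k A
    proof -
      have "(3 * k + 2) mod 3 = 2" "(3 * k + 2) div 3 = k" by presburger+
      then show ?thesis by (simp only: s_def) simp
    qed
    ultimately show "A = B" by blast
  qed
  moreover have "\<phi> A \<in> ?D" for A
  proof -
    have "s A (3 * k)" "\<not> s A (3 * k + 1)" "k \<le> 3 * k" "k \<le> 3 * k + 1" for k
      by (simp_all add: s_def)
    then have "\<exists>\<^sub>F i in sequentially. s A i" "\<exists>\<^sub>F i in sequentially. \<not> s A i"
      unfolding frequently_sequentially by blast+
    then have "\<not> convergent (\<lambda>i. (g ^^ i) (\<phi> A))"
      using \<phi> by (intro not_convergent_if_alternating[of _ "s A"])
    moreover have "(g ^^ i) (\<phi> A) \<in> {p False..q False} \<union> {p True..q True}" for i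
      using \<phi>[of i A] by (cases "s A i") auto
    ultimately show ?thesis by blast
  qed
  then have "range \<phi> \<subseteq> ?D" by blast
  then have "countable (range \<phi>)" using D by (rule countable_subset)
  ultimately have "countable (UNIV :: nat set set)"
    using countable_image_inj_on by blast
  then have "range (from_nat_into (UNIV :: nat set set)) = Pow UNIV"
    by (simp add: range_from_nat_into)
  then show False using Cantors_theorem[of "UNIV :: nat set"] by blast
qed

end

section \<open>Covering forced by infinite limits\<close>

text \<open>Close to one end \<open>g\<close> drops to \<open>A\<close> or below, close to the other
  it reaches \<open>B\<close> or more. Choosing \<open>p\<close> and \<open>q\<close> on different
  sides of the midpoint keeps \<open>p < q\<close>.\<close>

lemma continuous_covers_if_opposite_infinite_limits:
  fixes g :: "real \<Rightarrow> real"
  assumes "a < b" and lim: "opposite_infinite_limits g (at_right a) (at_left b)"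
    and cont: "continuous_on {a<..<b} g"
  shows "\<exists>p q. a < p \<and> p < q \<and> q < b \<and> {A..B} \<subseteq> g ` {p..q}"
proof -
  define m where "m = (a + b) / 2"
  have m: "a < m" "m < b" using \<open>a < b\<close> by (auto simp: m_def)
  have left: "\<exists>p. a < p \<and> p < m \<and> P p" if "eventually P (at_right a)" for P
  proof -
    have "eventually (\<lambda>x. P x \<and> x \<in> {a<..<m}) (at_right a)"
      using that m by (intro eventually_conj eventually_at_right_real) auto
    from eventually_happens[OF this] show ?thesis by auto
  qed
  have right: "\<exists>q. m < q \<and> q < b \<and> P q" if "eventually P (at_left b)" for P
  proof -
    have "eventually (\<lambda>x. P x \<and> x \<in> {m<..<b}) (at_left b)"
      using that m by (intro eventually_conj eventually_at_left_real) auto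
    from eventually_happens[OF this] show ?thesis by auto
  qed
  have cont': "continuous_on {p..q} g" if "a < p" "q < b" for p q
    by (rule continuous_on_subset[OF cont]) (use that in auto)
  from lim[unfolded opposite_infinite_limits_def] show ?thesis
  proof
    assume "filterlim g at_top (at_right a) \<and> filterlim g at_bot (at_left b)"
    then obtain p q where "a < p" "p < m" "B \<le> g p" "m < q" "q < b" "g q \<le> A"
      using left[of "\<lambda>x. B \<le> g x"] right[of "\<lambda>x. g x \<le> A"]
      by (auto simp: filterlim_at_top filterlim_at_bot)
    moreover have "y \<in> g ` {p..q}" if "y \<in> {A..B}" for y
    proof -
      have "g q \<le> y" "y \<le> g p" "p \<le> q" using calculation that by auto
      then show ?thesis
        using IVT2'[of g q y p, OF _ _ _ cont'[of p q]] calculation by (auto simp: image_iff)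
    qed
    ultimately show ?thesis by (intro exI[of _ p] exI[of _ q] conjI subsetI) auto
  next
    assume "filterlim g at_bot (at_right a) \<and> filterlim g at_top (at_left b)"
    then obtain p q where "a < p" "p < m" "g p \<le> A" "m < q" "q < b" "B \<le> g q"
      using left[of "\<lambda>x. g x \<le> A"] right[of "\<lambda>x. B \<le> g x"]
      by (auto simp: filterlim_at_top filterlim_at_bot)
    moreover have "y \<in> g ` {p..q}" if "y \<in> {A..B}" for y
    proof -
      have "g p \<le> y" "y \<le> g q" "p \<le> q" using calculation that by auto
      then show ?thesis
        using IVT'[of g p y q, OF _ _ _ cont'[of p q]] calculation by (auto simp: image_iff)
    qed
    ultimately show ?thesis by (intro exI[of _ p] exI[of _ q] conjI subsetI) auto
  qed
qed

section \<open>Damped Newton functions near critical points\<close>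

text \<open>Substitute \<open>l / deriv f x = - (newton_N l f x - x) / f x\<close>.\<close>

lemma newton_M_via_newton_N:
  assumes "f x \<noteq> 0" "deriv f x \<noteq> 0" "l \<noteq> 0"
  shows "newton_M l f x = x + (newton_N l f x - x) * (1 + f (newton_N l f x) / f x)"
  using assms unfolding newton_M_def
  by (simp add: newton_N_def[of l f x] field_simps)

text \<open>The quotient \<open>f x / deriv f x\<close> has a nonzero limit over a vanishing
  denominator and eventually has sign \<open>e\<close>. The filter \<open>F\<close> and the sign
  \<open>e\<close> treat both ends of an interval at once.\<close>

lemma newton_N_infinite_limit:
  fixes f :: "real \<Rightarrow> real"
  assumes "l > 0" and id: "((\<lambda>x. x) \<longlongrightarrow> c) F"
    and f: "(f \<longlongrightarrow> L) F"
    and f': "(deriv f \<longlongrightarrow> 0) F" and sgn: "eventually (\<lambda>x. sgn (deriv f x) = e * sgn L) F"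
    and "L \<noteq> 0" "\<bar>e\<bar> = 1"
  shows "filterlim (\<lambda>x. - e * newton_N l f x) at_top F"
proof -
  \<comment> \<open>\<open>k\<close> is the eventual sign of \<open>deriv f\<close>:
    \<open>k * deriv f x\<close> tends to 0 from above, so its inverse tends to
    +\<infinity>.\<close>
  define k where "k = e * sgn L"
  have k: "k * k = 1" and ek: "k * L = e * \<bar>L\<bar>"
    using \<open>L \<noteq> 0\<close> \<open>\<bar>e\<bar> = 1\<close> unfolding k_def by (auto simp: sgn_real_def abs_if split: if_splits)
  have "((\<lambda>x. k * deriv f x) \<longlongrightarrow> 0) F"
    using tendsto_mult_right_zero[OF f'] .
  moreover have "eventually (\<lambda>x. 0 < k * deriv f x) F"
    using sgn
  proof (rule eventually_mono)
    fix x assume "sgn (deriv f x) = e * sgn L"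
    then have k': "k = sgn (deriv f x)" by (simp add: k_def)
    then have "deriv f x \<noteq> 0" using k by auto
    then show "0 < k * deriv f x" using k' by (simp add: sgn_real_def)
  qed
  ultimately have "filterlim (\<lambda>x. inverse (k * deriv f x)) at_top F"
    by (rule filterlim_inverse_at_top)
  moreover have "((\<lambda>x. l * (e * k * f x)) \<longlongrightarrow> l * (e * k * L)) F"
    by (intro tendsto_intros f)
  moreover have "e * k * L = \<bar>L\<bar>"
    using ek \<open>\<bar>e\<bar> = 1\<close> by (simp add: abs_if split: if_splits)
  ultimately have "filterlim (\<lambda>x. l * (e * k * f x) * inverse (k * deriv f x)) at_top F"
    using \<open>l > 0\<close> \<open>L \<noteq> 0\<close> by (intro filterlim_tendsto_pos_mult_at_top[where c = "l * \<bar>L\<bar>"]) auto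
  then have "filterlim (\<lambda>x. - e * x + l * (e * k * f x) * inverse (k * deriv f x)) at_top F"
    by (rule filterlim_tendsto_add_at_top[OF tendsto_mult_left[OF id]])
  \<comment> \<open>The two factors \<open>k\<close> cancel. Where \<open>deriv f x = 0\<close>,
    both sides are \<open>- e * x\<close>, as division by zero yields 0.\<close>
  moreover have "- e * x + l * (e * k * f x) * inverse (k * deriv f x) = - e * newton_N l f x" for x
    using k by (auto simp: newton_N_def field_simps)
  ultimately show ?thesis by simp
qed

text \<open>In the formula of \<open>newton_M_via_newton_N\<close>, the factor
  \<open>newton_N l f x - x\<close> tends to infinity with sign \<open>e\<close>, and
  \<open>1 + f (newton_N l f x) / f x\<close> with sign \<open>t * sgn L\<close>. Their product
  outweighs the convergent summand \<open>x\<close>.\<close>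

lemma newton_M_infinite_limit:
  fixes f :: "real \<Rightarrow> real"
  assumes "l > 0" and id: "((\<lambda>x. x) \<longlongrightarrow> c) F" and f: "(f \<longlongrightarrow> L) F" and "L \<noteq> 0"
    and f': "eventually (\<lambda>x. deriv f x \<noteq> 0) F"
    and N: "filterlim (\<lambda>x. e * newton_N l f x) at_top F"
    and fN: "filterlim (\<lambda>x. t * f (newton_N l f x)) at_top F"
    and et: "\<bar>e\<bar> = 1" "\<bar>t\<bar> = 1"
  shows "filterlim (\<lambda>x. e * t * sgn L * newton_M l f x) at_top F"
proof -
  let ?N = "newton_N l f"
  define k where "k = t * sgn L"
  have k: "k * k = 1" "t * t = 1"
    using \<open>L \<noteq> 0\<close> et unfolding k_def by (auto simp: sgn_real_def abs_if split: if_splits)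
  have "((\<lambda>x. k * t * inverse (f x)) \<longlongrightarrow> k * t * inverse L) F"
    by (intro tendsto_intros f \<open>L \<noteq> 0\<close>)
  moreover have "k * t * inverse L = \<bar>inverse L\<bar>"
    using k et \<open>L \<noteq> 0\<close> unfolding k_def by (auto simp: sgn_real_def abs_if split: if_splits)
  ultimately have "filterlim (\<lambda>x. (k * t * inverse (f x)) * (t * f (?N x))) at_top F"
    using \<open>L \<noteq> 0\<close>
    by (intro filterlim_tendsto_pos_mult_at_top[where c = "\<bar>inverse L\<bar>", OF _ _ fN]) simp_all
  then have 1: "filterlim (\<lambda>x. k + (k * t * inverse (f x)) * (t * f (?N x))) at_top F"
    by (rule filterlim_tendsto_add_at_top[OF tendsto_const])
  have 2: "filterlim (\<lambda>x. - e * x + e * ?N x) at_top F"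
    by (rule filterlim_tendsto_add_at_top[OF tendsto_mult_left[OF id] N])
  \<comment> \<open>Along \<open>F\<close> this is eventually \<open>e * k * newton_M l f x\<close>,
    with \<open>e\<close> and \<open>k\<close> distributed over the two factors of the
    product.\<close>
  have "filterlim (\<lambda>x. e * k * x +
      (- e * x + e * ?N x) * (k + (k * t * inverse (f x)) * (t * f (?N x)))) at_top F"
    by (rule filterlim_tendsto_add_at_top[OF tendsto_mult_left[OF id] filterlim_at_top_mult_at_top[OF 2 1]])
  moreover have "eventually (\<lambda>x. e * k * x +
      (- e * x + e * ?N x) * (k + (k * t * inverse (f x)) * (t * f (?N x)))
      = e * t * sgn L * newton_M l f x) F"
    using f' tendsto_imp_eventually_ne[OF f \<open>L \<noteq> 0\<close>]
  proof eventually_elim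
    case (elim x)
    have "(k * t * inverse (f x)) * (t * f (?N x)) = (t * t) * (k * (f (?N x) / f x))"
      by (simp add: field_simps)
    then have 3: "(k * t * inverse (f x)) * (t * f (?N x)) = k * (f (?N x) / f x)"
      using k by simp
    show ?case unfolding 3 using elim \<open>l > 0\<close>
      by (simp add: newton_M_via_newton_N k_def algebra_simps)
  qed
  ultimately show ?thesis
    using filterlim_cong[OF refl refl] by fast
qed

section \<open>Signs and limits between consecutive critical points\<close>

lemma newton_map_differentiable: "newton_map f \<Longrightarrow> (f has_real_derivative deriv f x) (at x)"
  by (simp add: newton_map_def C2_fun_def differentiable_on_def DERIV_deriv_iff_real_differentiable)

lemma newton_map_isCont: "newton_map f \<Longrightarrow> isCont f x"
  using DERIV_isCont newton_map_differentiable by blast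

lemma newton_map_isCont_deriv: "newton_map f \<Longrightarrow> isCont (deriv f) x"
  unfolding newton_map_def C2_fun_def
  using differentiable_imp_continuous_on[of "deriv f" UNIV] continuous_on_eq_continuous_at open_UNIV
  by blast

lemma nonzero_continuous_constant_sgn:
  fixes h :: "real \<Rightarrow> real"
  assumes "connected S" "continuous_on S h" "\<And>x. x \<in> S \<Longrightarrow> h x \<noteq> 0" "x \<in> S" "y \<in> S"
  shows "sgn (h x) = sgn (h y)"
proof (rule ccontr)
  assume "\<not> ?thesis"
  then have "h x < 0 \<and> 0 < h y \<or> h y < 0 \<and> 0 < h x"
    using assms(3)[OF \<open>x \<in> S\<close>] assms(3)[OF \<open>y \<in> S\<close>] by (auto simp: sgn_real_def split: if_splits)
  then have "0 \<in> h ` S"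
    using connectedD_interval[OF connected_continuous_image[OF assms(2,1)], of "h x" "h y" 0]
      connectedD_interval[OF connected_continuous_image[OF assms(2,1)], of "h y" "h x" 0] assms(4,5)
    by auto
  then show False using assms(3) by force
qed

text \<open>\<open>deriv f\<close> keeps one sign \<open>u\<close> on the open interval, so
  \<open>f\<close> is strictly monotone up to the ends and changes from sign \<open>- u\<close> to
  sign \<open>u\<close> at \<open>r\<close>.\<close>

lemma critical_interval_signs:
  assumes f: "newton_map f" and c: "consecutive_roots (deriv f) c1 c2"
    and r: "r \<in> {c1<..<c2}" "f r = 0"
  obtains u where "\<bar>u\<bar> = 1" "\<And>x. x \<in> {c1<..<c2} \<Longrightarrow> sgn (deriv f x) = u"
    "sgn (f c1) = - u" "sgn (f c2) = u"
proof
  define u where "u = sgn (deriv f r)"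
  have nz: "\<And>x. x \<in> {c1<..<c2} \<Longrightarrow> deriv f x \<noteq> 0"
    using c by (auto simp: consecutive_roots_def)
  show "\<bar>u\<bar> = 1" using nz[OF r(1)] by (simp add: u_def)
  show sgn: "\<And>x. x \<in> {c1<..<c2} \<Longrightarrow> sgn (deriv f x) = u"
    unfolding u_def
    by (rule nonzero_continuous_constant_sgn[of "{c1<..<c2}" "deriv f"])
      (use nz r newton_map_isCont_deriv[OF f] in \<open>auto intro: continuous_at_imp_continuous_on\<close>)
  have diff: "(f has_real_derivative deriv f x) (at x)" for x
    using newton_map_differentiable[OF f] .
  \<comment> \<open>The mean value theorem evaluates \<open>deriv f\<close> strictly between
    \<open>x\<close> and \<open>y\<close>, so these may be the critical points themselves.\<close>
  have *: "sgn (f y - f x) = u" if "c1 \<le> x" "x < y" "y \<le> c2" for x y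
  proof -
    from MVT2[OF \<open>x < y\<close> diff] obtain z where z: "x < z" "z < y" "f y - f x = (y - x) * deriv f z"
      by blast
    then show ?thesis using sgn[of z] that by (simp add: sgn_mult)
  qed
  show "sgn (f c1) = - u" using *[of c1 r] r by (simp add: sgn_minus)
  show "sgn (f c2) = u" using *[of r c2] r by simp
qed

text \<open>Whichever sign \<open>u\<close> has, \<open>f\<close> and \<open>deriv f\<close> have
  opposite signs just after \<open>c1\<close> and equal signs just before \<open>c2\<close>. This is
  \<open>e = - 1\<close> and \<open>e = 1\<close> in \<open>newton_N_infinite_limit\<close>.\<close>

lemma newton_N_limits:
  assumes "l > 0" and f: "newton_map f" and c: "consecutive_roots (deriv f) c1 c2"
    and r: "r \<in> {c1<..<c2}" "f r = 0"
  shows "filterlim (newton_N l f) at_top (at_right c1)" "filterlim (newton_N l f) at_bot (at_left c2)"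
proof -
  from critical_interval_signs[OF f c r] obtain u where u: "\<bar>u\<bar> = 1"
    "\<And>x. x \<in> {c1<..<c2} \<Longrightarrow> sgn (deriv f x) = u" "sgn (f c1) = - u" "sgn (f c2) = u" by blast
  have cc: "c1 < c2" and z: "deriv f c1 = 0" "deriv f c2 = 0" using c by (auto simp: consecutive_roots_def)
  have nz: "f c1 \<noteq> 0" "f c2 \<noteq> 0" using u(1,3,4) by (metis abs_zero neg_equal_0_iff_equal sgn_0 zero_neq_one)+
  have lim: "(f \<longlongrightarrow> f x) (at x within S)" "(deriv f \<longlongrightarrow> deriv f x) (at x within S)" for x S
    using newton_map_isCont[OF f] newton_map_isCont_deriv[OF f]
    by (auto simp: isCont_def intro: tendsto_within_subset)
  have "filterlim (\<lambda>x. - (- 1) * newton_N l f x) at_top (at_right c1)"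
  proof (rule newton_N_infinite_limit[OF \<open>l > 0\<close> tendsto_ident_at lim(1)])
    show "\<forall>\<^sub>F x in at_right c1. sgn (deriv f x) = - 1 * sgn (f c1)"
      using eventually_at_right_real[OF cc] by eventually_elim (use u in auto)
  qed (use lim(2)[of c1] z nz in auto)
  then show "filterlim (newton_N l f) at_top (at_right c1)" by simp
  have "filterlim (\<lambda>x. - 1 * newton_N l f x) at_top (at_left c2)"
  proof (rule newton_N_infinite_limit[OF \<open>l > 0\<close> tendsto_ident_at lim(1)])
    show "\<forall>\<^sub>F x in at_left c2. sgn (deriv f x) = 1 * sgn (f c2)"
      using eventually_at_left_real[OF cc] by eventually_elim (use u in auto)
  qed (use lim(2)[of c2] z nz in auto)
  then show "filterlim (newton_N l f) at_bot (at_left c2)"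
    by (simp add: filterlim_uminus_at_bot)
qed

text \<open>From \<open>c1\<close> to \<open>c2\<close> three signs are reversed: those of the
  infinite limits of \<open>newton_N l f x\<close> and of \<open>f (newton_N l f x)\<close>, and
  that of \<open>f\<close> itself. Their product, the sign of the limit of
  \<open>newton_M l f\<close>, is therefore reversed as well.\<close>

lemma newton_M_limits:
  assumes "l > 0" and f: "newton_map f" and c: "consecutive_roots (deriv f) c1 c2"
    and r: "r \<in> {c1<..<c2}" "f r = 0" and lim_f: "opposite_infinite_limits f at_top at_bot"
  shows "opposite_infinite_limits (newton_M l f) (at_right c1) (at_left c2)"
proof -
  from critical_interval_signs[OF f c r] obtain u where u: "\<bar>u\<bar> = 1"
    "\<And>x. x \<in> {c1<..<c2} \<Longrightarrow> sgn (deriv f x) = u" "sgn (f c1) = - u" "sgn (f c2) = u" by blast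
  note N = newton_N_limits[OF \<open>l > 0\<close> f c r]
  have cc: "c1 < c2" using c by (auto simp: consecutive_roots_def)
  have nz: "f c1 \<noteq> 0" "f c2 \<noteq> 0" using u(1,3,4) by (metis abs_zero neg_equal_0_iff_equal sgn_0 zero_neq_one)+
  have deriv_nz: "deriv f x \<noteq> 0" if "x \<in> {c1<..<c2}" for x
    using c that by (simp add: consecutive_roots_def)
  have lim: "(f \<longlongrightarrow> f x) (at x within S)" for x S
    using newton_map_isCont[OF f] by (auto simp: isCont_def intro: tendsto_within_subset)
  \<comment> \<open>\<open>t\<close> is the sign of the limit of \<open>f\<close> at +\<infinity>,
    and \<open>- t\<close> the one at -\<infinity>.\<close>
  obtain t :: real where t: "\<bar>t\<bar> = 1"
    "filterlim (\<lambda>x. t * f x) at_top at_top" "filterlim (\<lambda>x. - t * f x) at_top at_bot"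
    using lim_f[unfolded opposite_infinite_limits_def]
  proof
    assume "filterlim f at_top at_top \<and> filterlim f at_bot at_bot"
    then show ?thesis by (intro that[of 1]) (auto simp: filterlim_uminus_at_bot)
  next
    assume "filterlim f at_bot at_top \<and> filterlim f at_top at_bot"
    then show ?thesis by (intro that[of "-1"]) (auto simp: filterlim_uminus_at_bot)
  qed
  have "filterlim (\<lambda>x. 1 * t * sgn (f c1) * newton_M l f x) at_top (at_right c1)"
  proof (rule newton_M_infinite_limit[OF \<open>l > 0\<close> tendsto_ident_at lim nz(1)])
    show "\<forall>\<^sub>F x in at_right c1. deriv f x \<noteq> 0"
      using eventually_at_right_real[OF cc] by (rule eventually_mono) (rule deriv_nz)
    show "filterlim (\<lambda>x. t * f (newton_N l f x)) at_top (at_right c1)"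
      by (rule filterlim_compose[OF t(2) N(1)])
  qed (use N t in auto)
  then have 1: "filterlim (\<lambda>x. - (t * u) * newton_M l f x) at_top (at_right c1)"
    by (simp add: u)
  have "filterlim (\<lambda>x. - 1 * - t * sgn (f c2) * newton_M l f x) at_top (at_left c2)"
  proof (rule newton_M_infinite_limit[OF \<open>l > 0\<close> tendsto_ident_at lim nz(2)])
    show "\<forall>\<^sub>F x in at_left c2. deriv f x \<noteq> 0"
      using eventually_at_left_real[OF cc] by (rule eventually_mono) (rule deriv_nz)
    show "filterlim (\<lambda>x. - t * f (newton_N l f x)) at_top (at_left c2)"
      by (rule filterlim_compose[OF t(3) N(2)])
  qed (use N t in \<open>auto simp: filterlim_uminus_at_bot\<close>)
  then have 2: "filterlim (\<lambda>x. (t * u) * newton_M l f x) at_top (at_left c2)"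
    by (simp add: u)
  have "\<bar>t * u\<bar> = 1" using t(1) u(1) by (simp add: abs_mult)
  then consider "t * u = 1" | "t * u = - 1" by linarith
  then show ?thesis
    by cases (use 1 2 in \<open>auto simp: opposite_infinite_limits_def filterlim_uminus_at_bot\<close>)
qed

lemma newton_M_continuous_on:
  assumes f: "newton_map f" and "\<And>x. x \<in> S \<Longrightarrow> deriv f x \<noteq> 0"
  shows "continuous_on S (newton_M l f)"
proof -
  have [continuous_intros]: "continuous_on T f" "continuous_on T (deriv f)" for T
    using newton_map_isCont[OF f] newton_map_isCont_deriv[OF f]
    by (auto intro: continuous_at_imp_continuous_on)
  have N: "continuous_on S (newton_N l f)"
    unfolding newton_N_def by (intro continuous_intros) (use assms in auto)
  have "continuous_on S (\<lambda>x. f (newton_N l f x))"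
    by (rule continuous_on_compose2[of UNIV f, OF _ N]) (auto intro: continuous_intros)
  then show ?thesis
    unfolding newton_M_def by (intro continuous_intros N) (use assms in auto)
qed

text \<open>Compactness and Rolle's theorem provide the critical points nearest to a root on either side.\<close>

lemma consecutive_critical_points_around_root:
  assumes f: "newton_map f" and rs: "r1 < r2" "r2 < r3" and z: "f r1 = 0" "f r2 = 0" "f r3 = 0"
  obtains c1 c2 where "r1 < c1" "c1 < r2" "r2 < c2" "c2 < r3" "consecutive_roots (deriv f) c1 c2"
proof -
  have nz: "f x = 0 \<Longrightarrow> deriv f x \<noteq> 0" for x using f by (simp add: newton_map_def)
  have compact: "compact {x \<in> {a..b}. deriv f x = 0}" for a b
  proof -
    have "closed {x \<in> {a..b}. deriv f x = 0}"
      using newton_map_isCont_deriv[OF f]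
      by (intro continuous_closed_preimage_constant continuous_at_imp_continuous_on) auto
    then show ?thesis by (rule closed_subset_interval_compact) auto
  qed
  have rolle: "{x \<in> {a..b}. deriv f x = 0} \<noteq> {}" if "a < b" "f a = 0" "f b = 0" for a b
  proof -
    obtain x where "a < x" "x < b" "DERIV f x :> 0"
    proof -
      have "continuous_on {a..b} f"
        using newton_map_isCont[OF f] by (simp add: continuous_at_imp_continuous_on)
      moreover have "f differentiable at x" for x
        using newton_map_differentiable[OF f] real_differentiable_def by blast
      ultimately show ?thesis using Rolle[of a b f] \<open>a < b\<close> \<open>f a = 0\<close> \<open>f b = 0\<close> that by auto
    qed
    then show ?thesis using DERIV_imp_deriv by force
  qed
  obtain c1 where c1: "c1 \<in> {r1..r2}" "deriv f c1 = 0" "\<And>x. x \<in> {r1..r2} \<Longrightarrow> deriv f x = 0 \<Longrightarrow> x \<le> c1"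
    using compact_attains_sup[OF compact rolle, of r1 r2] rs z by auto
  obtain c2 where c2: "c2 \<in> {r2..r3}" "deriv f c2 = 0" "\<And>x. x \<in> {r2..r3} \<Longrightarrow> deriv f x = 0 \<Longrightarrow> c2 \<le> x"
    using compact_attains_inf[OF compact rolle, of r2 r3] rs z by auto
  \<comment> \<open>A Newton map has nonzero derivative at its roots.\<close>
  have "c1 \<noteq> r1" "c1 \<noteq> r2" "c2 \<noteq> r2" "c2 \<noteq> r3" using nz z c1(2) c2(2) by metis+
  then have c: "r1 < c1" "c1 < r2" "r2 < c2" "c2 < r3" using c1(1) c2(1) by auto
  have "deriv f x \<noteq> 0" if "c1 < x" "x < c2" for x
    using that c c1(3)[of x] c2(3)[of x] by (cases "x \<le> r2") auto
  then have "consecutive_roots (deriv f) c1 c2"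
    using c c1(2) c2(2) by (auto simp: consecutive_roots_def)
  then show thesis using that c by blast
qed

section \<open>A horseshoe from four roots\<close>

lemma four_elements_sorted:
  fixes S :: "'a :: linorder set"
  assumes "finite S" "card S = 4"
  obtains a b c d where "a \<in> S" "b \<in> S" "c \<in> S" "d \<in> S" "a < b" "b < c" "c < d"
proof -
  let ?xs = "sorted_list_of_set S"
  have len: "length ?xs = 4" and s: "sorted_wrt (<) ?xs" and set: "set ?xs = S"
    using assms by (auto simp: strict_sorted_list_of_set)
  have "?xs ! i \<in> S" if "i < 4" for i using that len set nth_mem by metis
  moreover have "?xs ! i < ?xs ! Suc i" if "Suc i < 4" for i
    using sorted_wrt_nth_less[OF s, of i "Suc i"] that len by simp
  ultimately show thesis
    using that[of "?xs ! 0" "?xs ! 1" "?xs ! 2" "?xs ! 3"] by (simp add: numeral_eq_Suc)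
qed

text \<open>Each of the two middle roots has a root on either side, hence nearest critical points on
  either side. The two intervals so obtained carry the two symbols.\<close>

lemma newton_M_horseshoe:
  assumes "l > 0" and f: "newton_map f" and lim_f: "opposite_infinite_limits f at_top at_bot"
    and S: "S \<subseteq> {x. f x = 0}" "finite S" "card S = 4"
  obtains p q where "horseshoe (newton_M l f) p q" "\<And>b x. x \<in> {p b..q b} \<Longrightarrow> deriv f x \<noteq> 0"
proof -
  from four_elements_sorted[OF S(2,3)] obtain r1 r2 r3 r4
    where r: "r1 \<in> S" "r2 \<in> S" "r3 \<in> S" "r4 \<in> S" "r1 < r2" "r2 < r3" "r3 < r4" .
  then have z: "f r1 = 0" "f r2 = 0" "f r3 = 0" "f r4 = 0" using S(1) by auto
  obtain c1 c2 where c: "r1 < c1" "c1 < r2" "r2 < c2" "c2 < r3" "consecutive_roots (deriv f) c1 c2"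
    using consecutive_critical_points_around_root[OF f r(5,6) z(1,2,3)] by blast
  obtain d1 d2 where d: "r2 < d1" "d1 < r3" "r3 < d2" "d2 < r4" "consecutive_roots (deriv f) d1 d2"
    using consecutive_critical_points_around_root[OF f r(6,7) z(2,3,4)] by blast
  have nz: "deriv f x \<noteq> 0" if "x \<in> {c1<..<c2} \<or> x \<in> {d1<..<d2}" for x
    using c(5) d(5) that by (auto simp: consecutive_roots_def)
  \<comment> \<open>Otherwise \<open>d1\<close>, which exceeds \<open>r2\<close> and hence
    \<open>c1\<close>, would be a critical point inside \<open>{c1<..<c2}\<close>.\<close>
  have "c2 \<le> d1"
  proof (rule ccontr)
    assume "\<not> c2 \<le> d1"
    then have "deriv f d1 \<noteq> 0" using nz[of d1] c d by auto
    then show False using d(5) by (simp add: consecutive_roots_def)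
  qed
  have cont: "continuous_on T (newton_M l f)" if "T \<subseteq> {c1<..<c2} \<or> T \<subseteq> {d1<..<d2}" for T
    using that nz by (intro newton_M_continuous_on[OF f]) blast
  have limc: "opposite_infinite_limits (newton_M l f) (at_right c1) (at_left c2)"
    by (rule newton_M_limits[OF \<open>l > 0\<close> f c(5) _ z(2) lim_f]) (use c in auto)
  have limd: "opposite_infinite_limits (newton_M l f) (at_right d1) (at_left d2)"
    by (rule newton_M_limits[OF \<open>l > 0\<close> f d(5) _ z(3) lim_f]) (use d in auto)
  \<comment> \<open>The target \<open>{c1..d2}\<close> can be fixed before the compact intervals are
    chosen, as it will contain both of them.\<close>
  obtain p0 q0 where 0: "c1 < p0" "p0 < q0" "q0 < c2" "{c1..d2} \<subseteq> newton_M l f ` {p0..q0}"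
    using continuous_covers_if_opposite_infinite_limits[OF _ limc cont] c by force
  obtain p1 q1 where 1: "d1 < p1" "p1 < q1" "q1 < d2" "{c1..d2} \<subseteq> newton_M l f ` {p1..q1}"
    using continuous_covers_if_opposite_infinite_limits[OF _ limd cont] d by force
  let ?p = "\<lambda>b. if b then p1 else p0" and ?q = "\<lambda>b. if b then q1 else q0"
  have inside: "{?p b..?q b} \<subseteq> {c1<..<c2} \<or> {?p b..?q b} \<subseteq> {d1<..<d2}" for b
    using 0 1 by auto
  have hull: "{?p b..?q b} \<subseteq> {c1..d2}" for b using 0 1 \<open>c2 \<le> d1\<close> by auto
  have "horseshoe (newton_M l f) ?p ?q"
  proof
    show "?p b \<le> ?q b" for b using 0 1 by simp
    show "?q False < ?p True" using 0 1 \<open>c2 \<le> d1\<close> by simp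
    show "continuous_on {?p b..?q b} (newton_M l f)" for b by (rule cont[OF inside])
    show "{?p b'..?q b'} \<subseteq> newton_M l f ` {?p b..?q b}" for b b'
      using subset_trans[OF hull[of b'] 0(4)] subset_trans[OF hull[of b'] 1(4)] by (cases b) simp_all
  qed
  moreover have "deriv f x \<noteq> 0" if "x \<in> {?p b..?q b}" for b x
    using inside[of b] nz that by blast
  ultimately show thesis by (rule that)
qed

section \<open>Periodic points and the divergence set\<close>

text \<open>The orbit is in the \<open>True\<close> interval at times 0 and \<open>n\<close> and in
  the \<open>False\<close> interval at all times between, so an earlier return would put
  \<open>a\<close> into both.\<close>

lemma horseshoe_prime_period:
  assumes "horseshoe (newton_M l f) p q" and nz: "\<And>b x. x \<in> {p b..q b} \<Longrightarrow> deriv f x \<noteq> 0"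
    and "n \<ge> 1"
  shows "\<exists>a. M_prime_period l f n a"
proof -
  interpret horseshoe "newton_M l f" p q by fact
  \<comment> \<open>The symbol at \<open>n\<close> must agree with that at 0; for
    \<open>n = 1\<close> no \<open>False\<close> occurs up to time \<open>n\<close>, and
    \<open>a\<close> is a fixed point.\<close>
  let ?s = "\<lambda>i. i = 0 \<or> i = n"
  obtain a where a: "(newton_M l f ^^ n) a = a"
    "\<And>i. i \<le> n \<Longrightarrow> (newton_M l f ^^ i) a \<in> {p (?s i)..q (?s i)}"
    using periodic_itinerary[of ?s n] by auto
  have "M_returns l f n a"
    unfolding M_returns_def M_iter_defined_def using a nz \<open>n \<ge> 1\<close> by (meson less_imp_le)
  moreover have "\<not> M_returns l f m a" if "m < n" for m
  proof
    assume "M_returns l f m a"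
    then have "m \<ge> 1" "(newton_M l f ^^ m) a = a" by (auto simp: M_returns_def)
    then have "a \<in> {p False..q False}" "a \<in> {p True..q True}"
      using a(2)[of m] a(2)[of 0] that by auto
    then show False using symbol_unique by blast
  qed
  ultimately show ?thesis unfolding M_prime_period_def by blast
qed

text \<open>An orbit confined to the two intervals never meets a zero of \<open>deriv f\<close>, so
  all its iterates are genuinely defined.\<close>

lemma horseshoe_uncountable_divergence_set:
  assumes "horseshoe (newton_M l f) p q" and nz: "\<And>b x. x \<in> {p b..q b} \<Longrightarrow> deriv f x \<noteq> 0"
  shows "uncountable (M_divergence_set l f)"
proof -
  interpret horseshoe "newton_M l f" p q by fact
  have "deriv f x \<noteq> 0" if "x \<in> {p False..q False} \<union> {p True..q True}" for x
    using nz[of x False] nz[of x True] that by blast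
  then have "{x. (\<forall>i. (newton_M l f ^^ i) x \<in> {p False..q False} \<union> {p True..q True})
      \<and> \<not> convergent (\<lambda>i. (newton_M l f ^^ i) x)} \<subseteq> M_divergence_set l f"
    unfolding M_divergence_set_def M_iter_defined_def by (intro subsetI) simp
  then show ?thesis
    using uncountable_divergent countable_subset by blast
qed

theorem mainTheorem3:
  fixes l :: real
  assumes "l > 0"
  shows
    "(\<forall>(f :: real \<Rightarrow> real) c1 c2.
        newton_map f \<and> consecutive_roots (deriv f) c1 c2 \<and> (\<exists>!x. x \<in> {c1<..<c2} \<and> f x = 0)
        \<longrightarrow> opposite_infinite_limits (newton_N l f) (at_right c1) (at_left c2))
     \<and>
     (\<forall>f :: real \<Rightarrow> real.
        newton_map f \<and> opposite_infinite_limits f at_top at_bot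
          \<and> (\<exists>S. S \<subseteq> {x. f x = 0} \<and> finite S \<and> card S = 4)
        \<longrightarrow> (\<forall>n\<ge>1. \<exists>a. M_prime_period l f n a) \<and> uncountable (M_divergence_set l f))"
proof (intro conjI allI impI; elim conjE)
  fix f :: "real \<Rightarrow> real" and c1 c2
  assume "newton_map f" "consecutive_roots (deriv f) c1 c2" "\<exists>!x. x \<in> {c1<..<c2} \<and> f x = 0"
  \<comment> \<open>The first alternative always occurs: +\<infinity> at \<open>c1\<close> and
    -\<infinity> at \<open>c2\<close>.\<close>
  then show "opposite_infinite_limits (newton_N l f) (at_right c1) (at_left c2)"
    using newton_N_limits[OF assms] unfolding opposite_infinite_limits_def by blast
next
  fix f :: "real \<Rightarrow> real" and n :: nat
  assume f: "newton_map f" "opposite_infinite_limits f at_top at_bot"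
    and "\<exists>S. S \<subseteq> {x. f x = 0} \<and> finite S \<and> card S = 4" and n: "n \<ge> 1"
  then obtain S where S: "S \<subseteq> {x. f x = 0}" "finite S" "card S = 4" by blast
  show "\<exists>a. M_prime_period l f n a"
    by (rule newton_M_horseshoe[OF assms f S], rule horseshoe_prime_period[OF _ _ n]) assumption+
next
  fix f :: "real \<Rightarrow> real"
  assume f: "newton_map f" "opposite_infinite_limits f at_top at_bot"
    and "\<exists>S. S \<subseteq> {x. f x = 0} \<and> finite S \<and> card S = 4"
  then obtain S where S: "S \<subseteq> {x. f x = 0}" "finite S" "card S = 4" by blast
  show "uncountable (M_divergence_set l f)"
    by (rule newton_M_horseshoe[OF assms f S], rule horseshoe_uncountable_divergence_set) assumption+
qed

end
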